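(* Let $(X,d_X)$ and $(Y,d_Y)$ be pointed metric spaces with basepoints $e_X$ and $e_Y$, and let $\phi\colon Y\to X$ be a Lipschitz map with $\phi(e_Y)=e_X$. Assume that $X$ has the peak property. Then the composition operator $C_\phi\colon \mathrm{Lip}_0(X)\to \mathrm{Lip}_0(Y)$, $C_\phi f=f\circ\phi$, is an isometry if and only if $\phi$ is nonexpansive and satisfies the following property: for every $(x,y)\in\widetilde{X}$, there exists a sequence $\{(x_n,y_n)\}_{n\in\mathbb{N}}$ in $\widetilde{Y}$ such that $\phi(x_n)\to x$, $\phi(y_n)\to y$ and $$\frac{d_X(\phi(x_n),\phi(y_n))}{d_Y(x_n,y_n)}\to 1 \quad (n\to\infty).$$
   Context: A pointed metric space is a metric space $(X,d)$ with a designated basepoint $e_X\in X$. For a metric space $X$, $\widetilde{X}=\{(x,y)\in X\times X\colon x\neq y\}$. $\mathrm{Lip}_0(X)$ is the real Banach space of all Lipschitz functions $f\colon X\to\mathbb{R}$ with $f(e_X)=0$, with the norm $\mathrm{Lip}(f)=\sup\{|f(x)-f(y)|/d(x,y)\colon (x,y)\in\widetilde{X}\}$ (the supremum being $0$ if $\widetilde{X}=\emptyset$). Metric spaces are not assumed complete. A basepoint-preserving Lipschitz map $\phi\colon Y\to X$ induces the bounded linear operator $C_\phi\colon\mathrm{Lip}_0(X)\to\mathrm{Lip}_0(Y)$, $C_\phi f=f\circ\phi$. Isometry (not necessarily surjective) means $\mathrm{Lip}(f\circ\phi)=\mathrm{Lip}(f)$ for all $f\in\mathrm{Lip}_0(X)$.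 The map $\phi$ is nonexpansive if $d_X(\phi(u),\phi(v))\leq d_Y(u,v)$ for all $u,v\in Y$. A function $f\in\mathrm{Lip}_0(X)$ with $\mathrm{Lip}(f)\leq 1$ is said to peak at $(x,y)\in\widetilde{X}$ if $\frac{f(x)-f(y)}{d(x,y)}=1$ and for each open set $U\subset\widetilde{X}$ containing $(x,y)$ and $(y,x)$ there exists $\delta>0$ such that $\frac{|f(z)-f(w)|}{d(z,w)}\leq 1-\delta$ for all $(z,w)\in\widetilde{X}\setminus U$. The pointed metric space $X$ has the peak property if for every $(x,y)\in\widetilde{X}$ there is a function $f\in\mathrm{Lip}_0(X)$ with $\mathrm{Lip}(f)\leq 1$ that peaks at $(x,y)$. *)

theory Defs
  imports "HOL-Analysis.Analysis"
begin

text \<open>A pointed metric space is a type of class \<^class>\<open>metric_space\<close> together with an explicitly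
  given basepoint; no completeness is assumed.\<close>

definition offdiag :: "('a \<times> 'a) set"
  where "offdiag = {(x, y). x \<noteq> y}"

definition Lip0 :: "'a::metric_space \<Rightarrow> ('a \<Rightarrow> real) set"
  where "Lip0 e = {f. (\<exists>L. L-lipschitz_on UNIV f) \<and> f e = 0}"

text \<open>The one-point space is treated separately because the supremum of the empty set of reals
  is unspecified. For non-Lipschitz functions the set below is unbounded and the value is
  meaningless.\<close>

definition Lip :: "('a::metric_space \<Rightarrow> real) \<Rightarrow> real"
  where "Lip f = (if (offdiag :: ('a \<times> 'a) set) = {} then 0
                  else (SUP (x, y)\<in>offdiag. \<bar>f x - f y\<bar> / dist x y))"

definition comp_op :: "('b \<Rightarrow> 'a) \<Rightarrow> ('a \<Rightarrow> real) \<Rightarrow> ('b \<Rightarrow> real)"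
  where "comp_op \<phi> f = f \<circ> \<phi>"

lemma comp_op_in_Lip0:
  assumes "L-lipschitz_on UNIV \<phi>" and "\<phi> eY = eX" and "f \<in> Lip0 eX"
  shows "comp_op \<phi> f \<in> Lip0 eY"
proof -
  obtain M where M: "M-lipschitz_on UNIV f" and f0: "f eX = 0"
    using assms(3) by (auto simp: Lip0_def)
  have "(M * L)-lipschitz_on UNIV (f \<circ> \<phi>)"
    using assms(1) M by (metis lipschitz_on_compose lipschitz_on_subset top_greatest)
  then show ?thesis
    using f0 assms(2) by (auto simp: Lip0_def comp_op_def)
qed

text \<open>Not necessarily surjective isometries between spaces of Lipschitz functions; the argument
  is the basepoint of the domain space.\<close>

definition Lip0_isometry ::
    "'a::metric_space \<Rightarrow> (('a \<Rightarrow> real) \<Rightarrow> ('b::metric_space \<Rightarrow> real)) \<Rightarrow> bool"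
  where "Lip0_isometry e T \<longleftrightarrow> (\<forall>f\<in>Lip0 e. Lip (T f) = Lip f)"

definition nonexpansive :: "('b::metric_space \<Rightarrow> 'a::metric_space) \<Rightarrow> bool"
  where "nonexpansive \<phi> \<longleftrightarrow> (\<forall>u v. dist (\<phi> u) (\<phi> v) \<le> dist u v)"

definition peaks_at :: "('a::metric_space \<Rightarrow> real) \<Rightarrow> 'a \<Rightarrow> 'a \<Rightarrow> bool"
  where "peaks_at f x y \<longleftrightarrow>
    (f x - f y) / dist x y = 1 \<and>
    (\<forall>U. openin (top_of_set offdiag) U \<and> (x, y) \<in> U \<and> (y, x) \<in> U \<longrightarrow>
      (\<exists>\<delta>>0. \<forall>(z, w)\<in>offdiag - U. \<bar>f z - f w\<bar> / dist z w \<le> 1 - \<delta>))"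

definition peak_property :: "'a::metric_space \<Rightarrow> bool"
  where "peak_property e \<longleftrightarrow>
    (\<forall>(x, y)\<in>offdiag. \<exists>f\<in>Lip0 e. Lip f \<le> 1 \<and> peaks_at f x y)"

end

theory Submission
  imports Defs
begin

text \<open>
  Why the theorem holds. Write the Lipschitz quotient of \<open>f \<circ> \<phi>\<close> over a pair \<open>(a, b)\<close>
  with \<open>\<phi> a \<noteq> \<phi> b\<close> as
  \[ \frac{|f(\phi a) - f(\phi b)|}{d(a,b)} =
     \frac{|f(\phi a) - f(\phi b)|}{d(\phi a,\phi b)} \cdot \frac{d(\phi a,\phi b)}{d(a,b)}, \]
  the quotient of \<open>f\<close> over the image pair times the stretch of \<open>\<phi>\<close>.

  If \<open>\<phi>\<close> is nonexpansive, the stretch is at most \<open>1\<close>, so composition does not increase the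
  Lipschitz number; and pairs whose images approach \<open>(x, y)\<close> with stretch tending to \<open>1\<close>
  recover the quotient of \<open>f\<close> over \<open>(x, y)\<close> in the limit, so nothing is lost either
  (\<open>Lip_le_Lip_comp\<close>).

  Conversely, suppose that composition preserves Lipschitz numbers. Testing it on the distance
  from a point \<open>\<phi> v\<close> shows that \<open>\<phi>\<close> is nonexpansive (\<open>isometry_imp_nonexpansive\<close>). Testing it
  on a function \<open>f\<close> that peaks at \<open>(x, y)\<close> gives pairs \<open>(a, b)\<close> over which \<open>f \<circ> \<phi>\<close> has
  quotient close to \<open>1\<close>. Both factors above are at most \<open>1\<close>, hence both are close to \<open>1\<close>: the
  second one is the required stretch, and the first one forces \<open>(\<phi> a, \<phi> b)\<close>, by the peaking of
  \<open>f\<close>, to be close to \<open>(x, y)\<close> or to \<open>(y, x)\<close>. Interchanging \<open>a\<close> and \<open>b\<close> in the latter case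
  does not alter the stretch (\<open>peak_approximation\<close>).
\<close>

section \<open>The Lipschitz number\<close>

text \<open>For a Lipschitz function the supremum is over a bounded set, and so it is itself a
  Lipschitz constant.\<close>

lemma diff_le_Lip:
  fixes f :: "'a::metric_space \<Rightarrow> real"
  assumes "L-lipschitz_on UNIV f"
  shows "\<bar>f x - f y\<bar> \<le> Lip f * dist x y"
proof (cases "x = y")
  case False
  let ?q = "\<lambda>(x, y). \<bar>f x - f y\<bar> / dist x y"
  have "?q p \<le> L" if "p \<in> offdiag" for p
    using lipschitz_onD[OF assms, of "fst p" "snd p"] that
    by (auto simp: offdiag_def dist_real_def divide_le_eq split: prod.splits)
  then have "bdd_above (?q ` offdiag)"
    by (auto intro!: bdd_aboveI2)
  moreover have xy: "(x, y) \<in> offdiag"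
    using False by (simp add: offdiag_def)
  ultimately have "?q (x, y) \<le> (SUP p\<in>offdiag. ?q p)"
    by (rule cSUP_upper2) simp
  also have "\<dots> = Lip f"
    using xy by (auto simp: Lip_def)
  finally show ?thesis
    using False by (simp add: divide_le_eq)
qed simp

lemma Lip_le:
  fixes f :: "'a::metric_space \<Rightarrow> real"
  assumes "0 \<le> c" and "\<And>x y. \<bar>f x - f y\<bar> \<le> c * dist x y"
  shows "Lip f \<le> c"
proof (cases "(offdiag :: ('a \<times> 'a) set) = {}")
  case True
  then show ?thesis
    using assms(1) by (simp add: Lip_def)
next
  case False
  then have "(SUP p\<in>offdiag. (\<lambda>(x, y). \<bar>f x - f y\<bar> / dist x y) p) \<le> c"
    using assms(2) by (intro cSUP_least) (auto simp: offdiag_def divide_le_eq)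
  then show ?thesis
    using False by (simp add: Lip_def)
qed

lemma Lip_nonneg:
  fixes f :: "'a::metric_space \<Rightarrow> real"
  assumes "L-lipschitz_on UNIV f"
  shows "0 \<le> Lip f"
proof (cases "(offdiag :: ('a \<times> 'a) set) = {}")
  case True
  then show ?thesis
    by (simp add: Lip_def)
next
  case False
  then obtain x y :: 'a where "x \<noteq> y"
    by (auto simp: offdiag_def)
  moreover have "0 \<le> Lip f * dist x y"
    using diff_le_Lip[OF assms, of x y] by linarith
  ultimately show ?thesis
    by (simp add: zero_le_mult_iff)
qed

section \<open>Sufficiency: near-isometric pairs over every pair of points\<close>

lemma Lip_comp_le:
  fixes \<phi> :: "'b::metric_space \<Rightarrow> 'a::metric_space"
  assumes "nonexpansive \<phi>" and "L-lipschitz_on UNIV f"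
  shows "Lip (f \<circ> \<phi>) \<le> Lip f"
proof (rule Lip_le)
  show "0 \<le> Lip f"
    using assms(2) by (rule Lip_nonneg)
  fix u v
  have "\<bar>f (\<phi> u) - f (\<phi> v)\<bar> \<le> Lip f * dist (\<phi> u) (\<phi> v)"
    using assms(2) by (rule diff_le_Lip)
  also have "\<dots> \<le> Lip f * dist u v"
    using assms(1) \<open>0 \<le> Lip f\<close> by (auto simp: nonexpansive_def intro: mult_left_mono)
  finally show "\<bar>(f \<circ> \<phi>) u - (f \<circ> \<phi>) v\<bar> \<le> Lip f * dist u v"
    by simp
qed

text \<open>The estimate of \<open>f \<circ> \<phi>\<close> over \<open>(x\<^sub>n, y\<^sub>n)\<close> is multiplied by the stretch of that pair and
  passes to the limit in the resulting form, which contains no quotient of \<open>f\<close> over the image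
  pair and so makes sense even when the two images coincide.\<close>

lemma Lip_le_Lip_comp:
  fixes \<phi> :: "'b::metric_space \<Rightarrow> 'a::metric_space"
  assumes f: "L-lipschitz_on UNIV f" and f\<phi>: "M-lipschitz_on UNIV (f \<circ> \<phi>)"
    and approx: "\<And>x y. x \<noteq> y \<Longrightarrow> \<exists>xs ys :: nat \<Rightarrow> 'b.
      (\<forall>n. xs n \<noteq> ys n) \<and> (\<lambda>n. \<phi> (xs n)) \<longlonglongrightarrow> x \<and> (\<lambda>n. \<phi> (ys n)) \<longlonglongrightarrow> y \<and>
      (\<lambda>n. dist (\<phi> (xs n)) (\<phi> (ys n)) / dist (xs n) (ys n)) \<longlonglongrightarrow> 1"
  shows "Lip f \<le> Lip (f \<circ> \<phi>)"
proof (rule Lip_le)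
  show "0 \<le> Lip (f \<circ> \<phi>)"
    using f\<phi> by (rule Lip_nonneg)
  fix x y :: 'a
  show "\<bar>f x - f y\<bar> \<le> Lip (f \<circ> \<phi>) * dist x y"
  proof (cases "x = y")
    case False
    then obtain xs ys :: "nat \<Rightarrow> 'b"
      where ne: "\<And>n. xs n \<noteq> ys n"
        and xs: "(\<lambda>n. \<phi> (xs n)) \<longlonglongrightarrow> x" and ys: "(\<lambda>n. \<phi> (ys n)) \<longlonglongrightarrow> y"
        and stretch: "(\<lambda>n. dist (\<phi> (xs n)) (\<phi> (ys n)) / dist (xs n) (ys n)) \<longlonglongrightarrow> 1"
      using approx[OF False] by blast
    have "isCont f z" for z
      using lipschitz_on_continuous_on[OF f] by (simp add: continuous_on_eq_continuous_at)
    then have "(\<lambda>n. f (\<phi> (xs n))) \<longlonglongrightarrow> f x" "(\<lambda>n. f (\<phi> (ys n))) \<longlonglongrightarrow> f y"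
      using xs ys by (auto intro: isCont_tendsto_compose)
    then have "(\<lambda>n. \<bar>f (\<phi> (xs n)) - f (\<phi> (ys n))\<bar> *
        (dist (\<phi> (xs n)) (\<phi> (ys n)) / dist (xs n) (ys n))) \<longlonglongrightarrow> \<bar>f x - f y\<bar> * 1"
      using stretch by (intro tendsto_intros)
    moreover have "(\<lambda>n. Lip (f \<circ> \<phi>) * dist (\<phi> (xs n)) (\<phi> (ys n)))
        \<longlonglongrightarrow> Lip (f \<circ> \<phi>) * dist x y"
      using xs ys by (intro tendsto_intros)
    moreover have "\<bar>f (\<phi> (xs n)) - f (\<phi> (ys n))\<bar> *
        (dist (\<phi> (xs n)) (\<phi> (ys n)) / dist (xs n) (ys n))
        \<le> Lip (f \<circ> \<phi>) * dist (\<phi> (xs n)) (\<phi> (ys n))" for n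
      using mult_right_mono[OF diff_le_Lip[OF f\<phi>, of "xs n" "ys n"],
          of "dist (\<phi> (xs n)) (\<phi> (ys n)) / dist (xs n) (ys n)"] ne[of n]
      by simp
    ultimately show ?thesis
      using LIMSEQ_le by fastforce
  qed simp
qed

section \<open>Necessity: testing on distance functions and on peaking functions\<close>

text \<open>The distance from \<open>\<phi> v\<close>, shifted to vanish at the basepoint, has Lipschitz number at most
  \<open>1\<close> and attains the value \<open>d(\<phi> u, \<phi> v)\<close> as a difference over \<open>(\<phi> u, \<phi> v)\<close>.\<close>

lemma isometry_imp_nonexpansive:
  fixes \<phi> :: "'b::metric_space \<Rightarrow> 'a::metric_space"
  assumes "K-lipschitz_on UNIV \<phi>" and "\<phi> eY = eX" and iso: "Lip0_isometry eX (comp_op \<phi>)"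
  shows "nonexpansive \<phi>"
  unfolding nonexpansive_def
proof (intro allI)
  fix u v
  define f where "f = (\<lambda>z. dist z (\<phi> v) - dist eX (\<phi> v))"
  have "\<bar>f z - f w\<bar> \<le> 1 * dist z w" for z w
    unfolding f_def using dist_triangle[of z "\<phi> v" w] dist_triangle[of w "\<phi> v" z]
    by (simp add: dist_commute abs_le_iff)
  then have "1-lipschitz_on UNIV f" and Lf: "Lip f \<le> 1"
    by (auto intro!: lipschitz_onI Lip_le simp: dist_real_def)
  then have f0: "f \<in> Lip0 eX"
    by (auto simp: Lip0_def f_def)
  then obtain M where "M-lipschitz_on UNIV (f \<circ> \<phi>)"
    using comp_op_in_Lip0[OF assms(1,2)] by (fastforce simp: Lip0_def comp_op_def)
  then have "\<bar>(f \<circ> \<phi>) u - (f \<circ> \<phi>) v\<bar> \<le> Lip (f \<circ> \<phi>) * dist u v"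
    by (rule diff_le_Lip)
  also have "Lip (f \<circ> \<phi>) = Lip f"
    using iso f0 by (auto simp: Lip0_isometry_def comp_op_def)
  also have "Lip f * dist u v \<le> 1 * dist u v"
    using Lf by (intro mult_right_mono) auto
  finally show "dist (\<phi> u) (\<phi> v) \<le> dist u v"
    by (simp add: f_def)
qed

lemma Lip_peaking:
  assumes "L-lipschitz_on UNIV f" and "Lip f \<le> 1" and "peaks_at f x y"
  shows "Lip f = 1"
proof -
  have quotient: "(f x - f y) / dist x y = 1"
    using assms(3) unfolding peaks_at_def by (rule conjunct1)
  then have "x \<noteq> y"
    by auto
  then have "0 < dist x y"
    by simp
  moreover have "f x - f y = dist x y"
    using quotient \<open>x \<noteq> y\<close> by (simp only: divide_eq_1_iff)
  ultimately have "1 * dist x y \<le> Lip f * dist x y"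
    using diff_le_Lip[OF assms(1), of x y] by simp
  then show ?thesis
    using assms(2) \<open>0 < dist x y\<close> by (simp only: mult_le_cancel_right) auto
qed

text \<open>Peaking of \<open>f\<close>, applied to the union of two small balls around \<open>(x, y)\<close> and \<open>(y, x)\<close>.\<close>

lemma peaks_atD:
  assumes "peaks_at f x y" and "x \<noteq> y" and "0 < \<epsilon>"
  obtains \<delta> where "0 < \<delta>"
    and "\<And>z w. \<lbrakk>z \<noteq> w; (1 - \<delta>) * dist z w < \<bar>f z - f w\<bar>\<rbrakk>
      \<Longrightarrow> dist z x < \<epsilon> \<and> dist w y < \<epsilon> \<or> dist z y < \<epsilon> \<and> dist w x < \<epsilon>"
proof -
  define U where "U = offdiag \<inter> (ball x \<epsilon> \<times> ball y \<epsilon> \<union> ball y \<epsilon> \<times> ball x \<epsilon>)"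
  have "openin (top_of_set offdiag) U"
    unfolding U_def by (intro openin_open_Int open_Un open_Times open_ball)
  moreover have "(x, y) \<in> U" "(y, x) \<in> U"
    using assms(2,3) by (auto simp: U_def offdiag_def)
  ultimately have "\<exists>\<delta>>0. \<forall>(z, w)\<in>offdiag - U. \<bar>f z - f w\<bar> / dist z w \<le> 1 - \<delta>"
    using assms(1)[unfolded peaks_at_def, THEN conjunct2, THEN spec, of U] by simp
  then obtain \<delta> where "0 < \<delta>"
    and \<delta>: "\<And>z w. (z, w) \<in> offdiag - U \<Longrightarrow> \<bar>f z - f w\<bar> / dist z w \<le> 1 - \<delta>"
    by fast
  show ?thesis
  proof
    show "0 < \<delta>" by fact
    fix z w
    assume "z \<noteq> w" and "(1 - \<delta>) * dist z w < \<bar>f z - f w\<bar>"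
    then have "(z, w) \<in> U"
      using \<delta>[of z w] by (auto simp: offdiag_def divide_le_eq)
    then show "dist z x < \<epsilon> \<and> dist w y < \<epsilon> \<or> dist z y < \<epsilon> \<and> dist w x < \<epsilon>"
      by (auto simp: U_def dist_commute)
  qed
qed

text \<open>The heart of the necessity part: a pair over which \<open>f \<circ> \<phi>\<close> almost attains the Lipschitz
  number \<open>1\<close> is nearly isometric for \<open>\<phi>\<close> and has its image where \<open>f\<close> peaks.\<close>

lemma peak_approximation:
  fixes \<phi> :: "'b::metric_space \<Rightarrow> 'a::metric_space"
  assumes "nonexpansive \<phi>" and f: "L-lipschitz_on UNIV f" "Lip f \<le> 1"
    and peak: "peaks_at f x y" and "x \<noteq> y" and Lip1: "1 \<le> Lip (f \<circ> \<phi>)" and "0 < \<epsilon>"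
  shows "\<exists>a b. a \<noteq> b \<and> dist (\<phi> a) x < \<epsilon> \<and> dist (\<phi> b) y < \<epsilon> \<and>
    \<bar>dist (\<phi> a) (\<phi> b) / dist a b - 1\<bar> < \<epsilon>"
proof -
  obtain \<delta> where "0 < \<delta>"
    and \<delta>: "\<And>z w. \<lbrakk>z \<noteq> w; (1 - \<delta>) * dist z w < \<bar>f z - f w\<bar>\<rbrakk>
      \<Longrightarrow> dist z x < \<epsilon> \<and> dist w y < \<epsilon> \<or> dist z y < \<epsilon> \<and> dist w x < \<epsilon>"
    using peaks_atD[OF peak \<open>x \<noteq> y\<close> \<open>0 < \<epsilon>\<close>] by blast
  \<comment> \<open>Keeping \<open>c\<close> nonnegative ensures that a quotient above \<open>c\<close> is nonzero, so that the pair
    found below has distinct images.\<close>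
  define c where "c = max 0 (1 - min \<delta> \<epsilon>)"
  have c: "0 \<le> c" "c < 1" "1 - \<delta> \<le> c" "1 - \<epsilon> \<le> c"
    using \<open>0 < \<delta>\<close> \<open>0 < \<epsilon>\<close> by (auto simp: c_def)
  obtain a b where ab: "c * dist a b < \<bar>f (\<phi> a) - f (\<phi> b)\<bar>"
    using Lip_le[of c "f \<circ> \<phi>", OF c(1)] c(2) Lip1 by (auto simp: not_le[symmetric])
  moreover have "0 \<le> c * dist a b"
    using c(1) by simp
  ultimately have "\<phi> a \<noteq> \<phi> b"
    by auto
  then have "a \<noteq> b"
    by auto
  have le: "dist (\<phi> a) (\<phi> b) \<le> dist a b"
    using assms(1) by (simp add: nonexpansive_def)
  have "c * dist (\<phi> a) (\<phi> b) \<le> c * dist a b"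
    using le c(1) by (rule mult_left_mono)
  moreover have "(1 - \<delta>) * dist (\<phi> a) (\<phi> b) \<le> c * dist (\<phi> a) (\<phi> b)"
    using c(3) by (rule mult_right_mono) simp
  ultimately have near: "dist (\<phi> a) x < \<epsilon> \<and> dist (\<phi> b) y < \<epsilon> \<or>
      dist (\<phi> a) y < \<epsilon> \<and> dist (\<phi> b) x < \<epsilon>"
    using \<delta>[OF \<open>\<phi> a \<noteq> \<phi> b\<close>] ab by linarith
  have "\<bar>f (\<phi> a) - f (\<phi> b)\<bar> \<le> Lip f * dist (\<phi> a) (\<phi> b)"
    using f(1) by (rule diff_le_Lip)
  also have "\<dots> \<le> 1 * dist (\<phi> a) (\<phi> b)"
    using f(2) by (rule mult_right_mono) simp
  finally have "c * dist a b < dist (\<phi> a) (\<phi> b)"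
    using ab by simp
  then have "c < dist (\<phi> a) (\<phi> b) / dist a b"
    using \<open>a \<noteq> b\<close> by (simp add: less_divide_eq)
  moreover have "dist (\<phi> a) (\<phi> b) / dist a b \<le> 1"
    using le \<open>a \<noteq> b\<close> by (simp add: divide_le_eq)
  ultimately have stretch: "\<bar>dist (\<phi> a) (\<phi> b) / dist a b - 1\<bar> < \<epsilon>"
    using c(4) \<open>0 < \<epsilon>\<close> by linarith
  then have swapped: "\<bar>dist (\<phi> b) (\<phi> a) / dist b a - 1\<bar> < \<epsilon>"
    by (simp add: dist_commute)
  from near show ?thesis
  proof
    assume "dist (\<phi> a) x < \<epsilon> \<and> dist (\<phi> b) y < \<epsilon>"
    then show ?thesis
      using stretch \<open>a \<noteq> b\<close> by (intro exI[of _ a] exI[of _ b]) simp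
  next
    assume "dist (\<phi> a) y < \<epsilon> \<and> dist (\<phi> b) x < \<epsilon>"
    then show ?thesis
      using swapped \<open>a \<noteq> b\<close> by (intro exI[of _ b] exI[of _ a]) simp
  qed
qed

lemma tendsto_if_dist_less_inverse_Suc:
  assumes "\<And>n. dist (s n) l < inverse (real (Suc n))"
  shows "s \<longlonglongrightarrow> l"
proof (rule metric_LIMSEQ_I)
  fix r :: real
  assume "0 < r"
  then obtain N where "inverse (real (Suc N)) < r"
    using reals_Archimedean by blast
  moreover have "inverse (real (Suc n)) \<le> inverse (real (Suc N))" if "N \<le> n" for n
    using that by (intro le_imp_inverse_le) auto
  ultimately show "\<exists>N. \<forall>n\<ge>N. dist (s n) l < r"
    using assms by (meson le_less_trans less_trans less_le_trans)
qed

section \<open>Isometric composition operators\<close>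

theorem theorem2p4:
  fixes eX :: "'a::metric_space" and eY :: "'b::metric_space" and \<phi> :: "'b \<Rightarrow> 'a"
  assumes "\<exists>L. L-lipschitz_on UNIV \<phi>"
    and "\<phi> eY = eX"
    and "peak_property eX"
  shows "Lip0_isometry eX (comp_op \<phi>) \<longleftrightarrow>
    nonexpansive \<phi> \<and>
    (\<forall>(x, y)\<in>offdiag. \<exists>xs ys :: nat \<Rightarrow> 'b.
      (\<forall>n. (xs n, ys n) \<in> offdiag) \<and>
      (\<lambda>n. \<phi> (xs n)) \<longlonglongrightarrow> x \<and>
      (\<lambda>n. \<phi> (ys n)) \<longlonglongrightarrow> y \<and>
      (\<lambda>n. dist (\<phi> (xs n)) (\<phi> (ys n)) / dist (xs n) (ys n)) \<longlonglongrightarrow> 1)"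
    (is "?iso \<longleftrightarrow> nonexpansive \<phi> \<and> ?approx")
proof -
  obtain K where K: "K-lipschitz_on UNIV \<phi>"
    using assms(1) by blast
  show ?thesis
  proof (intro iffI conjI)
    assume iso: ?iso
    show ne: "nonexpansive \<phi>"
      using K assms(2) iso by (rule isometry_imp_nonexpansive)
    show ?approx
    proof clarify
      fix x y :: 'a
      assume xy: "(x, y) \<in> offdiag"
      then have "x \<noteq> y"
        by (simp add: offdiag_def)
      obtain f where f0: "f \<in> Lip0 eX" and f1: "Lip f \<le> 1" and peak: "peaks_at f x y"
        using assms(3) xy unfolding peak_property_def by blast
      obtain L where f: "L-lipschitz_on UNIV f"
        using f0 by (auto simp: Lip0_def)
      have "1 \<le> Lip (f \<circ> \<phi>)"
        using iso f0 Lip_peaking[OF f f1 peak] by (simp add: Lip0_isometry_def comp_op_def)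
      then have "\<exists>a b. a \<noteq> b \<and> dist (\<phi> a) x < inverse (real (Suc n)) \<and>
          dist (\<phi> b) y < inverse (real (Suc n)) \<and>
          dist (dist (\<phi> a) (\<phi> b) / dist a b) 1 < inverse (real (Suc n))" for n
        unfolding dist_real_def
        by (intro peak_approximation[OF ne f f1 peak \<open>x \<noteq> y\<close>]) simp_all
      then obtain xs ys where "\<And>n. xs n \<noteq> ys n"
        and "\<And>n. dist (\<phi> (xs n)) x < inverse (real (Suc n))"
        and "\<And>n. dist (\<phi> (ys n)) y < inverse (real (Suc n))"
        and "\<And>n. dist (dist (\<phi> (xs n)) (\<phi> (ys n)) / dist (xs n) (ys n)) 1
              < inverse (real (Suc n))"
        by metis
      then show "\<exists>xs ys :: nat \<Rightarrow> 'b. (\<forall>n. (xs n, ys n) \<in> offdiag) \<and>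
          (\<lambda>n. \<phi> (xs n)) \<longlonglongrightarrow> x \<and> (\<lambda>n. \<phi> (ys n)) \<longlonglongrightarrow> y \<and>
          (\<lambda>n. dist (\<phi> (xs n)) (\<phi> (ys n)) / dist (xs n) (ys n)) \<longlonglongrightarrow> 1"
        by (intro exI[of _ xs] exI[of _ ys] conjI tendsto_if_dist_less_inverse_Suc)
          (simp_all add: offdiag_def)
    qed
  next
    assume "nonexpansive \<phi> \<and> ?approx"
    then have ne: "nonexpansive \<phi>" and approx: ?approx
      by simp_all
    show ?iso
      unfolding Lip0_isometry_def comp_op_def
    proof
      fix f
      assume f0: "f \<in> Lip0 eX"
      obtain L where f: "L-lipschitz_on UNIV f"
        using f0 by (auto simp: Lip0_def)
      obtain M where f\<phi>: "M-lipschitz_on UNIV (f \<circ> \<phi>)"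
        using comp_op_in_Lip0[OF K assms(2) f0] by (auto simp: Lip0_def comp_op_def)
      have "Lip f \<le> Lip (f \<circ> \<phi>)"
        using approx by (intro Lip_le_Lip_comp[OF f f\<phi>]) (simp add: offdiag_def)
      then show "Lip (f \<circ> \<phi>) = Lip f"
        using Lip_comp_le[OF ne f] by simp
    qed
  qed
qed

end
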